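(* The function $\widehat{G}\to\operatorname{Irr}(H)$ given by $\rho\mapsto\overline{V}(\rho)$ is injective.
   Context: $\mathbb{K}$ is an algebraically closed field of characteristic zero, $G$ is a finitely generated abelian group, $\widehat{G}$ is the group of homomorphisms $G\to\mathbb{K}^\times$, $\chi\in\widehat{G}$ has finite order $n$, and $b,c\in G$ satisfy $\chi(b)=\chi(c)$ and $bc\neq1$. Put $e=c^{-1}-b\in\mathbb{K}[G]$. $H=H(G,\chi,\chi^{-1},b,c,1)$ is (after replacing its second Ore variable $y$ by $c^{-1}y$) the algebra generated by $G,x,y$ subject to the relations of $G$ and $xg=\chi(g)gx$, $yg=\chi(g)^{-1}gy$ $(g\in G)$, $yx=xy+e$; it has $\mathbb{K}$-basis $\{gx^iy^j\mid g\in G,\ i,j\ge 0\}$. $\operatorname{Irr}(H)$ is the set of isomorphism classes of finite dimensional simple left $H$-modules. Let $\sigma:\mathbb{K}[G]\to\mathbb{K}[G]$ be the automorphism with $\sigma(g)=\chi(g)g$, and for $u\in\mathbb{K}[G]$ let $[u]_i^\sigma=\sum_{k=0}^{i-1}\sigma^{-k}(u)$ for $i\ge1$, $[u]_0^\sigma=0$. Characters $\rho\in\widehat{G}$ are extended to algebra maps $\rho:\mathbb{K}[G]\to\mathbb{K}$. $V(\rho)$ is the $H$-module with basis $\{v_i\mid i\ge0\}$ and action $x\cdot v_i=v_{i+1}$, $g\cdot v_i=\rho(\sigma^{-i}(g))v_i$ for $g\in G$, $y\cdot v_0=0$, $y\cdot v_i=\rho([e]_i^\sigma)v_{i-1}$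 for $i\ge1$. Since $\chi$ has order $n$, $[e]_n^\sigma=0$. Let $d$ be the least positive integer such that $\rho([e]_d^\sigma)=0$, and set $\overline{V}(\rho)=V(\rho)/Hv_d$, a $d$-dimensional simple module with basis the images of $v_0,\ldots,v_{d-1}$.
   Formalization: If χ(b)=1 then [e]_n=ne is not 0 and d may fail to exist (e.g. χ trivial, ρ(bc)≠1); there V̄(ρ) is taken to be V(ρ). Injectivity is on all of Ĝ; values in Irr(H) are claimed for every ρ for which d exists, so for all ρ if χ(b)≠1. *)

theory Defs
  imports
    "HOL-Library.Poly_Mapping"
    "HOL-Computational_Algebra.Polynomial"
    "HOL-Computational_Algebra.Group_Closure"
    "HOL-Algebra.Algebra"
begin

text \<open>
  The abelian group \<open>G\<close> is a type \<open>'g :: ab_group_add\<close> and is written additively: the product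
  \<open>bc\<close> is \<open>b + c\<close>, the inverse of \<open>c\<close> is \<open>- c\<close>, and the neutral element is \<open>0\<close>. The group algebra
  of \<open>G\<close> is \<open>'g \<Rightarrow>\<^sub>0 'k\<close> with its convolution product; \<open>g\<close> is \<open>single g 1\<close>.
\<close>

definition fin_gen_group :: "'g::ab_group_add itself \<Rightarrow> bool" where
  "fin_gen_group _ \<longleftrightarrow> (\<exists>S :: 'g set. finite S \<and> group_closure S = UNIV)"

definition char_group :: "('g::ab_group_add \<Rightarrow> 'k::field) monoid" where
  "char_group =
    \<lparr>carrier = {\<chi>. (\<forall>g. \<chi> g \<noteq> 0) \<and> (\<forall>g h. \<chi> (g + h) = \<chi> g * \<chi> h)},
     mult = (\<lambda>\<chi> \<psi> g. \<chi> g * \<psi> g),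
     one = (\<lambda>_. 1)\<rparr>"

definition char_ext :: "('g \<Rightarrow> 'k::field) \<Rightarrow> ('g \<Rightarrow>\<^sub>0 'k) \<Rightarrow> 'k" where
  "char_ext \<rho> u = (\<Sum>g\<in>Poly_Mapping.keys u. Poly_Mapping.lookup u g * \<rho> g)"

definition sigma :: "('g \<Rightarrow> 'k::field) \<Rightarrow> ('g \<Rightarrow>\<^sub>0 'k) \<Rightarrow> ('g \<Rightarrow>\<^sub>0 'k)" where
  "sigma \<chi> = Poly_Mapping.mapp (\<lambda>g a. \<chi> g * a)"

definition sigma_sum :: "('g \<Rightarrow> 'k::field) \<Rightarrow> ('g \<Rightarrow>\<^sub>0 'k) \<Rightarrow> nat \<Rightarrow> ('g \<Rightarrow>\<^sub>0 'k)" where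
  "sigma_sum \<chi> u i = (\<Sum>k<i. (inv_into UNIV (sigma \<chi>) ^^ k) u)"

definition e_elt :: "'g::ab_group_add \<Rightarrow> 'g \<Rightarrow> ('g \<Rightarrow>\<^sub>0 'k::field)" where
  "e_elt b c = Poly_Mapping.single (- c) 1 - Poly_Mapping.single b 1"


section \<open>The algebra \<open>H\<close>\<close>

text \<open>The free monoid, written additively so that \<open>'a free_monoid \<Rightarrow>\<^sub>0 'k\<close> with its
  convolution product is the free associative unital algebra on \<open>'a\<close>.\<close>

datatype 'a free_monoid = Word (letters: "'a list")

instantiation free_monoid :: (type) monoid_add
begin

definition "0 = Word []"

definition "u + v = Word (letters u @ letters v)"

instance
  by standard (auto simp: zero_free_monoid_def plus_free_monoid_def)

end

datatype 'g gen = Grp 'g | Xg | Yg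

type_synonym ('g, 'k) free_alg = "'g gen free_monoid \<Rightarrow>\<^sub>0 'k"

definition gen :: "'g gen \<Rightarrow> ('g, 'k::field) free_alg" where
  "gen a = Poly_Mapping.single (Word [a]) 1"

definition scal :: "'k::field \<Rightarrow> ('g, 'k) free_alg" where
  "scal k = Poly_Mapping.single 0 k"

definition free_alg_ring :: "('g, 'k::field) free_alg ring" where
  "free_alg_ring = \<lparr>carrier = UNIV, mult = (*), one = 1, ring.zero = 0, ring.add = (+)\<rparr>"

definition H_rels :: "('g::ab_group_add \<Rightarrow> 'k::field) \<Rightarrow> 'g \<Rightarrow> 'g \<Rightarrow> ('g, 'k) free_alg set" where
  "H_rels \<chi> b c =
     {gen (Grp 0) - 1}
     \<union> {gen (Grp g) * gen (Grp h) - gen (Grp (g + h)) | g h. True}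
     \<union> {gen Xg * gen (Grp g) - scal (\<chi> g) * gen (Grp g) * gen Xg | g. True}
     \<union> {gen Yg * gen (Grp g) - scal (inverse (\<chi> g)) * gen (Grp g) * gen Yg | g. True}
     \<union> {gen Yg * gen Xg - (gen Xg * gen Yg + (gen (Grp (- c)) - gen (Grp b)))}"

definition H_ideal :: "('g::ab_group_add \<Rightarrow> 'k::field) \<Rightarrow> 'g \<Rightarrow> 'g \<Rightarrow> ('g, 'k) free_alg set" where
  "H_ideal \<chi> b c = Idl\<^bsub>free_alg_ring\<^esub> (H_rels \<chi> b c)"

definition H_alg :: "('g::ab_group_add \<Rightarrow> 'k::field) \<Rightarrow> 'g \<Rightarrow> 'g \<Rightarrow> ('g, 'k) free_alg set ring" where
  "H_alg \<chi> b c = free_alg_ring Quot H_ideal \<chi> b c"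

definition H_scal :: "('g::ab_group_add \<Rightarrow> 'k::field) \<Rightarrow> 'g \<Rightarrow> 'g \<Rightarrow> 'k \<Rightarrow> ('g, 'k) free_alg set" where
  "H_scal \<chi> b c k = H_ideal \<chi> b c +>\<^bsub>free_alg_ring\<^esub> scal k"


section \<open>Left modules over a ring that need not be commutative\<close>

text \<open>The record \<open>module\<close> of the library is reused; its fields \<open>mult\<close> and \<open>one\<close> play no role. The
  locale \<open>module\<close> asks for a commutative ring, but \<open>submodule\<close> does not.\<close>

locale left_module = R?: ring R + M?: abelian_group M
  for R :: "('r, 'm) ring_scheme" (structure) and M :: "('r, 'v) module" (structure) +
  assumes smult_closed:
      "\<lbrakk>a \<in> carrier R; v \<in> carrier M\<rbrakk> \<Longrightarrow> a \<odot>\<^bsub>M\<^esub> v \<in> carrier M"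
    and smult_l_distr:
      "\<lbrakk>a \<in> carrier R; a' \<in> carrier R; v \<in> carrier M\<rbrakk> \<Longrightarrow>
        (a \<oplus>\<^bsub>R\<^esub> a') \<odot>\<^bsub>M\<^esub> v = a \<odot>\<^bsub>M\<^esub> v \<oplus>\<^bsub>M\<^esub> a' \<odot>\<^bsub>M\<^esub> v"
    and smult_r_distr:
      "\<lbrakk>a \<in> carrier R; v \<in> carrier M; w \<in> carrier M\<rbrakk> \<Longrightarrow>
        a \<odot>\<^bsub>M\<^esub> (v \<oplus>\<^bsub>M\<^esub> w) = a \<odot>\<^bsub>M\<^esub> v \<oplus>\<^bsub>M\<^esub> a \<odot>\<^bsub>M\<^esub> w"
    and smult_assoc:
      "\<lbrakk>a \<in> carrier R; a' \<in> carrier R; v \<in> carrier M\<rbrakk> \<Longrightarrow>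
        (a \<otimes>\<^bsub>R\<^esub> a') \<odot>\<^bsub>M\<^esub> v = a \<odot>\<^bsub>M\<^esub> (a' \<odot>\<^bsub>M\<^esub> v)"
    and smult_one:
      "v \<in> carrier M \<Longrightarrow> \<one>\<^bsub>R\<^esub> \<odot>\<^bsub>M\<^esub> v = v"

definition simple_module :: "('r, 'm) ring_scheme \<Rightarrow> ('r, 'v) module \<Rightarrow> bool" where
  "simple_module R M \<longleftrightarrow> left_module R M \<and> carrier M \<noteq> {\<zero>\<^bsub>M\<^esub>} \<and>
     (\<forall>N. submodule N R M \<longrightarrow> N = {\<zero>\<^bsub>M\<^esub>} \<or> N = carrier M)"

definition module_isos ::
  "('r, 'm) ring_scheme \<Rightarrow> ('r, 'v) module \<Rightarrow> ('r, 'w) module \<Rightarrow> ('v \<Rightarrow> 'w) set" where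
  "module_isos R M N = {f. bij_betw f (carrier M) (carrier N) \<and>
     (\<forall>v\<in>carrier M. \<forall>w\<in>carrier M. f (v \<oplus>\<^bsub>M\<^esub> w) = f v \<oplus>\<^bsub>N\<^esub> f w) \<and>
     (\<forall>a\<in>carrier R. \<forall>v\<in>carrier M. f (a \<odot>\<^bsub>M\<^esub> v) = a \<odot>\<^bsub>N\<^esub> f v)}"

definition iso_class :: "('r, 'm) ring_scheme \<Rightarrow> ('r, 'v) module \<Rightarrow> ('r, 'v) module set" where
  "iso_class R M = {N. left_module R N \<and> module_isos R M N \<noteq> {}}"

text \<open>Quotient of a module by a submodule, in the style of \<open>FactRing\<close>.\<close>

definition quot_module :: "('r, 'v) module \<Rightarrow> 'v set \<Rightarrow> ('r, 'v set) module" where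
  "quot_module M N =
    \<lparr>carrier = a_rcosets\<^bsub>M\<^esub> N, mult = undefined, one = undefined, ring.zero = N, ring.add = set_add M,
     smult = (\<lambda>a C. \<Union>v\<in>C. N +>\<^bsub>M\<^esub> (a \<odot>\<^bsub>M\<^esub> v))\<rparr>"

definition H_fin_dim ::
  "('g::ab_group_add \<Rightarrow> 'k::field) \<Rightarrow> 'g \<Rightarrow> 'g \<Rightarrow> (('g, 'k) free_alg set, 'v) module \<Rightarrow> bool" where
  "H_fin_dim \<chi> b c M \<longleftrightarrow> (\<exists>B. finite B \<and> B \<subseteq> carrier M \<and>
     (\<forall>v\<in>carrier M. \<exists>a. v = (\<Oplus>\<^bsub>M\<^esub>w\<in>B. H_scal \<chi> b c (a w) \<odot>\<^bsub>M\<^esub> w)))"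

text \<open>A finite dimensional module has a copy on every type that has at least as many elements as
  the field, so for such a type \<open>'v\<close> nothing is lost by using only modules with elements in \<open>'v\<close>.\<close>

definition Irr ::
  "('g::ab_group_add \<Rightarrow> 'k::field) \<Rightarrow> 'g \<Rightarrow> 'g \<Rightarrow> (('g, 'k) free_alg set, 'v) module set set" where
  "Irr \<chi> b c = iso_class (H_alg \<chi> b c) ` {M. simple_module (H_alg \<chi> b c) M \<and> H_fin_dim \<chi> b c M}"


section \<open>The modules \<open>V(\<rho>)\<close> and their simple quotients\<close>

text \<open>The underlying space of \<open>V(\<rho>)\<close> is \<open>nat \<Rightarrow>\<^sub>0 'k\<close>, and \<open>v\<^sub>i\<close> is \<open>single i 1\<close>.\<close>

definition vscale :: "'k::field \<Rightarrow> (nat \<Rightarrow>\<^sub>0 'k) \<Rightarrow> (nat \<Rightarrow>\<^sub>0 'k)" where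
  "vscale a = Poly_Mapping.map ((*) a)"

definition lin_ext :: "('i \<Rightarrow> (nat \<Rightarrow>\<^sub>0 'k::field)) \<Rightarrow> ('i \<Rightarrow>\<^sub>0 'k) \<Rightarrow> (nat \<Rightarrow>\<^sub>0 'k)" where
  "lin_ext f u = (\<Sum>i\<in>Poly_Mapping.keys u. vscale (Poly_Mapping.lookup u i) (f i))"

fun basis_act ::
  "('g::ab_group_add \<Rightarrow> 'k::field) \<Rightarrow> 'g \<Rightarrow> 'g \<Rightarrow> ('g \<Rightarrow> 'k) \<Rightarrow> 'g gen \<Rightarrow> nat \<Rightarrow> (nat \<Rightarrow>\<^sub>0 'k)" where
  "basis_act \<chi> b c \<rho> (Grp g) i =
     Poly_Mapping.single i (char_ext \<rho> ((inv_into UNIV (sigma \<chi>) ^^ i) (Poly_Mapping.single g 1)))"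
| "basis_act \<chi> b c \<rho> Xg i = Poly_Mapping.single (Suc i) 1"
| "basis_act \<chi> b c \<rho> Yg 0 = 0"
| "basis_act \<chi> b c \<rho> Yg (Suc i) =
     Poly_Mapping.single i (char_ext \<rho> (sigma_sum \<chi> (e_elt b c) (Suc i)))"

definition free_act ::
  "('g::ab_group_add \<Rightarrow> 'k::field) \<Rightarrow> 'g \<Rightarrow> 'g \<Rightarrow> ('g \<Rightarrow> 'k) \<Rightarrow>
    ('g, 'k) free_alg \<Rightarrow> (nat \<Rightarrow>\<^sub>0 'k) \<Rightarrow> (nat \<Rightarrow>\<^sub>0 'k)" where
  "free_act \<chi> b c \<rho> p v =
     lin_ext (\<lambda>u. foldr (\<lambda>a. lin_ext (basis_act \<chi> b c \<rho> a)) (letters u) v) p"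

text \<open>An element of \<open>H\<close> is a coset all of whose members act on \<open>V(\<rho>)\<close> in the same way, because the
  defining relations of \<open>H\<close> act as \<open>0\<close>; \<open>the_elem\<close> picks the common value.\<close>

definition V_mod ::
  "('g::ab_group_add \<Rightarrow> 'k::field) \<Rightarrow> 'g \<Rightarrow> 'g \<Rightarrow> ('g \<Rightarrow> 'k) \<Rightarrow>
    (('g, 'k) free_alg set, nat \<Rightarrow>\<^sub>0 'k) module" where
  "V_mod \<chi> b c \<rho> =
    \<lparr>carrier = UNIV, mult = undefined, one = undefined, ring.zero = 0, ring.add = (+),
     smult = (\<lambda>h v. the_elem ((\<lambda>p. free_act \<chi> b c \<rho> p v) ` h))\<rparr>"

definition has_d :: "('g::ab_group_add \<Rightarrow> 'k::field) \<Rightarrow> 'g \<Rightarrow> 'g \<Rightarrow> ('g \<Rightarrow> 'k) \<Rightarrow> bool" where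
  "has_d \<chi> b c \<rho> \<longleftrightarrow> (\<exists>d>0. char_ext \<rho> (sigma_sum \<chi> (e_elt b c) d) = 0)"

definition the_d :: "('g::ab_group_add \<Rightarrow> 'k::field) \<Rightarrow> 'g \<Rightarrow> 'g \<Rightarrow> ('g \<Rightarrow> 'k) \<Rightarrow> nat" where
  "the_d \<chi> b c \<rho> = (LEAST d. 0 < d \<and> char_ext \<rho> (sigma_sum \<chi> (e_elt b c) d) = 0)"

text \<open>If \<open>\<chi> b = 1\<close>, the integer \<open>d\<close> need not exist: \<open>[e]\<^sub>i\<close> is then \<open>i * e\<close>. In that case there is no
  \<open>v\<^sub>d\<close> to divide out, and the submodule below is taken to be \<open>0\<close>, that is, \<open>Vbar_mod\<close> is \<open>V(\<rho>)\<close>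
  itself.\<close>

definition Hv_d ::
  "('g::ab_group_add \<Rightarrow> 'k::field) \<Rightarrow> 'g \<Rightarrow> 'g \<Rightarrow> ('g \<Rightarrow> 'k) \<Rightarrow> (nat \<Rightarrow>\<^sub>0 'k) set" where
  "Hv_d \<chi> b c \<rho> =
     (if has_d \<chi> b c \<rho>
      then (\<lambda>h. h \<odot>\<^bsub>V_mod \<chi> b c \<rho>\<^esub> Poly_Mapping.single (the_d \<chi> b c \<rho>) 1) ` carrier (H_alg \<chi> b c)
      else {0})"

definition Vbar_mod ::
  "('g::ab_group_add \<Rightarrow> 'k::field) \<Rightarrow> 'g \<Rightarrow> 'g \<Rightarrow> ('g \<Rightarrow> 'k) \<Rightarrow>
    (('g, 'k) free_alg set, (nat \<Rightarrow>\<^sub>0 'k) set) module" where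
  "Vbar_mod \<chi> b c \<rho> = quot_module (V_mod \<chi> b c \<rho>) (Hv_d \<chi> b c \<rho>)"

definition Vbar_class ::
  "('g::ab_group_add \<Rightarrow> 'k::field) \<Rightarrow> 'g \<Rightarrow> 'g \<Rightarrow> ('g \<Rightarrow> 'k) \<Rightarrow>
    (('g, 'k) free_alg set, (nat \<Rightarrow>\<^sub>0 'k) set) module set" where
  "Vbar_class \<chi> b c \<rho> = iso_class (H_alg \<chi> b c) (Vbar_mod \<chi> b c \<rho>)"

end

theory Submission
  imports Defs
begin

text \<open>
  The character \<open>\<rho>\<close> can be read off from the isomorphism type of the quotient of \<open>V(\<rho>)\<close>. Write
  \<open>r\<^sub>i = \<rho>([e]\<^sub>i)\<close>. Since \<open>y v\<^sub>i = r\<^sub>i v\<^bsub>i-1\<^esub>\<close> and no \<open>r\<^sub>i\<close> with \<open>0 < i < d\<close> vanishes, the vectors of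
  the quotient that \<open>y\<close> kills are exactly the multiples of \<open>v\<^sub>0\<close>, and \<open>G\<close> acts on \<open>v\<^sub>0\<close> through \<open>\<rho>\<close>. An
  isomorphism preserves the kernel of \<open>y\<close> and the action of \<open>G\<close> on it, so it preserves \<open>\<rho>\<close>
  (\<open>lowest_weight_unique\<close>, \<open>Vbar_iso_imp_eq\<close>). If \<open>d\<close> does not exist,
  no \<open>r\<^sub>i\<close> with \<open>i > 0\<close> vanishes, the quotient is \<open>V(\<rho>)\<close> itself, and the argument is the same.

  If \<open>d\<close> exists, \<open>v\<^sub>0, \<dots>, v\<^bsub>d-1\<^esub>\<close> span the quotient, and it is simple: a power of \<open>y\<close> carries a nonzero
  vector to a nonzero multiple of \<open>v\<^sub>0\<close>, and the powers of \<open>x\<close> carry \<open>v\<^sub>0\<close> to all other \<open>v\<^sub>i\<close>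
  (\<open>simple_Vbar\<close>, \<open>fin_dim_Vbar\<close>). If \<open>q = \<chi>(b) = \<chi>(c)\<close> is not \<open>1\<close>, then \<open>d\<close> exists because \<open>r\<^sub>n\<close> is a
  combination of the geometric sums of \<open>q\<close> and \<open>1/q\<close> over a full period.

  All of this rests on two concrete descriptions. The generators of \<open>H\<close> act on coefficients by
  explicit formulas (\<open>lookup_act\<close>), from which the defining relations of \<open>H\<close>, and hence the
  whole ideal that they generate, act as \<open>0\<close> (\<open>act_H_ideal\<close>). And \<open>Hv\<^sub>d\<close> consists of the vectors
  whose coefficients below \<open>d\<close> vanish (\<open>Hv_d_eq\<close>), so that a coset of it is given by the first \<open>d\<close>
  coefficients of any representative.
\<close>

abbreviation lookup :: "('a \<Rightarrow>\<^sub>0 'b::zero) \<Rightarrow> 'a \<Rightarrow> 'b" where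
  "lookup \<equiv> Poly_Mapping.lookup"

abbreviation single :: "'a \<Rightarrow> 'b::zero \<Rightarrow> 'a \<Rightarrow>\<^sub>0 'b" where
  "single \<equiv> Poly_Mapping.single"

section \<open>Finitely supported functions and linear extension\<close>

lemma poly_mapping_eq_sum_single:
  fixes u :: "'a \<Rightarrow>\<^sub>0 'b::comm_monoid_add"
  shows "u = (\<Sum>i\<in>Poly_Mapping.keys u. single i (lookup u i))"
  by (rule poly_mapping_eqI)
    (auto simp: lookup_sum lookup_single when_def sum.delta in_keys_iff)

text \<open>A finitely supported function is a finite sum of one-point functions, so every statement that is
  additive in such a function, or in an element of a group algebra or free algebra, need only be
  checked on one-point functions.\<close>

lemma poly_mapping_additive_induct [case_names add single]:
  fixes u :: "'a \<Rightarrow>\<^sub>0 'b::comm_monoid_add"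
  assumes add: "\<And>u v. P u \<Longrightarrow> P v \<Longrightarrow> P (u + v)"
    and single: "\<And>i a. P (single i a)"
  shows "P u"
proof -
  have "P (\<Sum>i\<in>S. single i (lookup u i))" if "finite S" for S
    using that
  proof (induction S)
    case empty
    show ?case using single[of undefined 0] by simp
  qed (simp add: add single)
  then show ?thesis
    by (metis poly_mapping_eq_sum_single finite_keys)
qed

lemma lookup_vscale [simp]: "lookup (vscale a v) i = a * lookup v i"
  by (simp add: vscale_def Poly_Mapping.map.rep_eq when_def)

lemma vscale_simps [simp]:
  "vscale a 0 = 0" "vscale 0 v = 0" "vscale 1 v = v" "vscale a (single i x) = single i (a * x)"
  "vscale a (vscale x v) = vscale (a * x) v"
  by (auto intro!: poly_mapping_eqI simp: lookup_single when_def algebra_simps)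

lemma vscale_add:
  "vscale a (u + v) = vscale a u + vscale a v" "vscale (a + x) v = vscale a v + vscale x v"
  by (auto intro!: poly_mapping_eqI simp: lookup_add algebra_simps)

lemma vscale_sum: "vscale a (sum f S) = (\<Sum>i\<in>S. vscale a (f i))"
  by (induction S rule: infinite_finite_induct) (simp_all add: vscale_add)

lemma lin_ext_superset:
  assumes "finite S" "Poly_Mapping.keys u \<subseteq> S"
  shows "lin_ext f u = (\<Sum>i\<in>S. vscale (lookup u i) (f i))"
  unfolding lin_ext_def by (rule sum.mono_neutral_left) (use assms in \<open>auto simp: in_keys_iff\<close>)

lemma lin_ext_zero [simp]: "lin_ext f 0 = 0"
  by (simp add: lin_ext_def)

lemma lin_ext_single [simp]: "lin_ext f (single i a) = vscale a (f i)"
  by (subst lin_ext_superset[of "{i}"]) auto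

lemma lin_ext_add: "lin_ext f (u + v) = lin_ext f u + lin_ext f v"
proof -
  let ?S = "Poly_Mapping.keys u \<union> Poly_Mapping.keys v"
  have "Poly_Mapping.keys (u + v) \<subseteq> ?S" by (rule keys_add)
  then show ?thesis
    by (simp add: lin_ext_superset[of ?S] lookup_add vscale_add sum.distrib)
qed

lemma lin_ext_vscale: "lin_ext f (vscale a u) = vscale a (lin_ext f u)"
  by (induction u rule: poly_mapping_additive_induct) (simp_all add: vscale_add lin_ext_add)

lemma lin_ext_add_fun: "lin_ext (\<lambda>i. f i + h i) u = lin_ext f u + lin_ext h u"
  by (simp add: lin_ext_def vscale_add sum.distrib)

lemma lin_ext_vscale_fun: "lin_ext (\<lambda>i. vscale a (f i)) u = vscale a (lin_ext f u)"
  by (simp add: lin_ext_def vscale_sum mult.commute)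

section \<open>Characters and the twist \<open>\<sigma>\<close>\<close>

lemma char_groupD:
  assumes "\<rho> \<in> carrier char_group"
  shows "\<rho> g \<noteq> 0" "\<rho> (g + h) = \<rho> g * \<rho> h" "\<rho> 0 = 1" "\<rho> (- g) = inverse (\<rho> g)"
proof -
  have nz: "\<rho> g \<noteq> 0" and mult: "\<rho> (g + h) = \<rho> g * \<rho> h" for g h
    using assms by (auto simp: char_group_def)
  show "\<rho> g \<noteq> 0" "\<rho> (g + h) = \<rho> g * \<rho> h" by (fact nz, fact mult)
  show 1: "\<rho> 0 = 1"
    using mult[of 0 0] nz[of 0] by simp
  show "\<rho> (- g) = inverse (\<rho> g)"
    using mult[of g "- g"] nz[of g] 1 by (simp add: inverse_unique)
qed

lemma group_char_group: "group (char_group :: ('g::ab_group_add \<Rightarrow> 'k::field) monoid)"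
proof (rule groupI)
  fix \<rho> :: "'g \<Rightarrow> 'k"
  assume \<rho>: "\<rho> \<in> carrier char_group"
  have "(\<lambda>g. inverse (\<rho> g)) \<in> carrier char_group"
    using \<rho> by (simp add: char_group_def)
  moreover have "(\<lambda>g. inverse (\<rho> g)) \<otimes>\<^bsub>char_group\<^esub> \<rho> = \<one>\<^bsub>char_group\<^esub>"
    using \<rho> by (auto simp: char_group_def)
  ultimately show "\<exists>\<psi>\<in>carrier char_group. \<psi> \<otimes>\<^bsub>char_group\<^esub> \<rho> = \<one>\<^bsub>char_group\<^esub>" by blast
qed (auto simp: char_group_def mult.assoc)

text \<open>The power of \<open>\<chi>\<close> in the group of characters is the pointwise power.\<close>

lemma char_pow_ord:
  fixes \<chi> :: "'g::ab_group_add \<Rightarrow> 'k::field"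
  assumes "\<chi> \<in> carrier char_group"
  shows "\<chi> g ^ group.ord char_group \<chi> = 1"
proof -
  interpret C: group "char_group :: ('g \<Rightarrow> 'k) monoid" by (rule group_char_group)
  have "(\<chi> [^]\<^bsub>char_group\<^esub> (m::nat)) = (\<lambda>g. \<chi> g ^ m)" for m
    by (induction m) (auto simp: char_group_def mult.commute)
  from this[of "group.ord char_group \<chi>"] C.pow_ord_eq_1[OF assms] show ?thesis
    by (simp add: char_group_def) metis
qed

lemma char_ext_superset:
  assumes "finite S" "Poly_Mapping.keys u \<subseteq> S"
  shows "char_ext \<rho> u = (\<Sum>g\<in>S. lookup u g * \<rho> g)"
  unfolding char_ext_def by (rule sum.mono_neutral_left) (use assms in \<open>auto simp: in_keys_iff\<close>)

lemma char_ext_single [simp]: "char_ext \<rho> (single g a) = a * \<rho> g"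
  by (subst char_ext_superset[of "{g}"]) auto

lemma char_ext_zero [simp]: "char_ext \<rho> 0 = 0"
  by (simp add: char_ext_def)

lemma char_ext_add: "char_ext \<rho> (u + v) = char_ext \<rho> u + char_ext \<rho> v"
proof -
  let ?S = "Poly_Mapping.keys u \<union> Poly_Mapping.keys v"
  have "Poly_Mapping.keys (u + v) \<subseteq> ?S" by (rule keys_add)
  then show ?thesis
    by (simp add: char_ext_superset[of ?S] lookup_add distrib_right sum.distrib)
qed

lemma lookup_sigma: "lookup (sigma \<chi> u) g = \<chi> g * lookup u g"
  by (simp add: sigma_def lookup_mapp when_def in_keys_iff)

text \<open>Coefficientwise, \<open>\<sigma>\<close> multiplies by the values of \<open>\<chi>\<close>, which are units; so its inverse divides by
  them.\<close>

lemma inv_sigma_pow: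
  assumes "\<And>g. \<chi> g \<noteq> 0"
  shows "lookup ((inv_into UNIV (sigma \<chi>) ^^ i) u) g = lookup u g / \<chi> g ^ i"
proof -
  have inv: "inv_into UNIV (sigma \<chi>) = sigma (\<lambda>g. inverse (\<chi> g))"
  proof (rule inv_unique_comp)
    show "sigma \<chi> \<circ> sigma (\<lambda>g. inverse (\<chi> g)) = id" "sigma (\<lambda>g. inverse (\<chi> g)) \<circ> sigma \<chi> = id"
      using assms by (auto intro!: ext poly_mapping_eqI simp: lookup_sigma)
  qed
  show ?thesis
    unfolding inv by (induction i) (simp_all add: lookup_sigma field_simps)
qed

section \<open>The algebra \<open>H\<close> as a quotient of the free algebra\<close>

lemma free_alg_ring_simps [simp]:
  "carrier free_alg_ring = UNIV" "p \<otimes>\<^bsub>free_alg_ring\<^esub> q = p * q" "p \<oplus>\<^bsub>free_alg_ring\<^esub> q = p + q"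
  "\<one>\<^bsub>free_alg_ring\<^esub> = 1" "\<zero>\<^bsub>free_alg_ring\<^esub> = 0"
  by (simp_all add: free_alg_ring_def)

lemma ring_free_alg: "ring (free_alg_ring :: ('g, 'k::field) free_alg ring)"
proof (rule ringI)
  show "abelian_group (free_alg_ring :: ('g, 'k) free_alg ring)"
  proof (rule abelian_groupI)
    fix p :: "('g, 'k) free_alg"
    have "- p + p = 0" by simp
    then show "\<exists>q\<in>carrier free_alg_ring. q \<oplus>\<^bsub>free_alg_ring\<^esub> p = \<zero>\<^bsub>free_alg_ring\<^esub>"
      by (metis UNIV_I free_alg_ring_simps(1,3,5))
  qed (simp_all add: algebra_simps)
  show "Group.monoid (free_alg_ring :: ('g, 'k) free_alg ring)"
    by (rule monoidI) (simp_all add: mult.assoc)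
qed (simp_all add: algebra_simps)

lemma ideal_H_ideal: "ideal (H_ideal \<chi> b c) free_alg_ring"
  unfolding H_ideal_def by (rule ring.genideal_ideal[OF ring_free_alg]) simp

text \<open>The image in \<open>H\<close> of an element of the free algebra. All computations in \<open>H\<close> are done on such
  representatives.\<close>

definition H_class :: "('g::ab_group_add \<Rightarrow> 'k::field) \<Rightarrow> 'g \<Rightarrow> 'g \<Rightarrow> ('g, 'k) free_alg \<Rightarrow>
    ('g, 'k) free_alg set" where
  "H_class \<chi> b c p = H_ideal \<chi> b c +>\<^bsub>free_alg_ring\<^esub> p"

lemma ring_H_alg: "ring (H_alg \<chi> b c)"
  unfolding H_alg_def by (rule ideal.quotient_is_ring[OF ideal_H_ideal])

lemma H_alg_simps:
  "carrier (H_alg \<chi> b c) = range (H_class \<chi> b c)"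
  "\<one>\<^bsub>H_alg \<chi> b c\<^esub> = H_class \<chi> b c 1"
  "H_class \<chi> b c p \<oplus>\<^bsub>H_alg \<chi> b c\<^esub> H_class \<chi> b c q = H_class \<chi> b c (p + q)"
  "H_class \<chi> b c p \<otimes>\<^bsub>H_alg \<chi> b c\<^esub> H_class \<chi> b c q = H_class \<chi> b c (p * q)"
proof -
  interpret I: ideal "H_ideal \<chi> b c" free_alg_ring by (rule ideal_H_ideal)
  show "carrier (H_alg \<chi> b c) = range (H_class \<chi> b c)"
    by (auto simp: H_alg_def FactRing_def A_RCOSETS_def' H_class_def)
  show "\<one>\<^bsub>H_alg \<chi> b c\<^esub> = H_class \<chi> b c 1"
    by (simp add: H_alg_def FactRing_def H_class_def)
  show "H_class \<chi> b c p \<oplus>\<^bsub>H_alg \<chi> b c\<^esub> H_class \<chi> b c q = H_class \<chi> b c (p + q)"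
    using I.a_rcos_sum[of p q] by (simp add: H_alg_def FactRing_def H_class_def)
  show "H_class \<chi> b c p \<otimes>\<^bsub>H_alg \<chi> b c\<^esub> H_class \<chi> b c q = H_class \<chi> b c (p * q)"
    using I.rcoset_mult_add[of p q] by (simp add: H_alg_def FactRing_def H_class_def)
qed

lemma H_class_eq: "H_class \<chi> b c p = (\<lambda>h. h + p) ` H_ideal \<chi> b c"
  by (auto simp: H_class_def a_r_coset_def')

section \<open>Quotients of left modules\<close>

lemma module_isos_id: "id \<in> module_isos R M M"
  by (simp add: module_isos_def)

context
  fixes R :: "('r, 'm) ring_scheme" and M :: "('r, 'v) module" and N :: "'v set"
  assumes M: "left_module R M" and N: "submodule N R M"
begin

interpretation M: left_module R M by (rule M)
interpretation S: submodule N R M by (rule N)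
interpretation A: abelian_subgroup N M
  by (intro abelian_subgroupI3 additive_subgroupI S.subgroup_axioms M.abelian_group_axioms)

lemma quot_module_simps:
  "carrier (quot_module M N) = (\<lambda>v. N +>\<^bsub>M\<^esub> v) ` carrier M"
  "\<zero>\<^bsub>quot_module M N\<^esub> = N"
  "\<lbrakk>v \<in> carrier M; w \<in> carrier M\<rbrakk> \<Longrightarrow>
    (N +>\<^bsub>M\<^esub> v) \<oplus>\<^bsub>quot_module M N\<^esub> (N +>\<^bsub>M\<^esub> w) = N +>\<^bsub>M\<^esub> (v \<oplus>\<^bsub>M\<^esub> w)"
  by (auto simp: quot_module_def A_RCOSETS_def' A.a_rcos_sum)

text \<open>The union over the coset in \<open>quot_module\<close> is a union of equal sets: since \<open>N\<close> is closed under the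
  action of \<open>a\<close>, representatives of the same coset have images in the same coset.\<close>

lemma quot_module_smult:
  assumes "a \<in> carrier R" "v \<in> carrier M"
  shows "a \<odot>\<^bsub>quot_module M N\<^esub> (N +>\<^bsub>M\<^esub> v) = N +>\<^bsub>M\<^esub> (a \<odot>\<^bsub>M\<^esub> v)"
proof -
  have "N +>\<^bsub>M\<^esub> (a \<odot>\<^bsub>M\<^esub> w) = N +>\<^bsub>M\<^esub> (a \<odot>\<^bsub>M\<^esub> v)" if "w \<in> N +>\<^bsub>M\<^esub> v" for w
  proof -
    from that obtain h where h: "h \<in> N" "w = h \<oplus>\<^bsub>M\<^esub> v" by (auto simp: a_r_coset_def')
    then have "a \<odot>\<^bsub>M\<^esub> w = a \<odot>\<^bsub>M\<^esub> h \<oplus>\<^bsub>M\<^esub> a \<odot>\<^bsub>M\<^esub> v"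
      using assms A.a_subset by (simp add: M.smult_r_distr subset_iff)
    then have "a \<odot>\<^bsub>M\<^esub> w \<in> N +>\<^bsub>M\<^esub> (a \<odot>\<^bsub>M\<^esub> v)"
      using h assms S.smult_closed by (auto simp: a_r_coset_def')
    then show ?thesis
      using A.a_repr_independence'[of "a \<odot>\<^bsub>M\<^esub> w" "a \<odot>\<^bsub>M\<^esub> v"] assms M.smult_closed by simp
  qed
  moreover have "v \<in> N +>\<^bsub>M\<^esub> v" using A.a_rcos_self assms by simp
  ultimately have "(\<Union>w\<in>N +>\<^bsub>M\<^esub> v. N +>\<^bsub>M\<^esub> (a \<odot>\<^bsub>M\<^esub> w)) = N +>\<^bsub>M\<^esub> (a \<odot>\<^bsub>M\<^esub> v)" by blast
  then show ?thesis by (simp add: quot_module_def)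
qed

lemma left_module_quot: "left_module R (quot_module M N)"
proof -
  have zero: "N +>\<^bsub>M\<^esub> \<zero>\<^bsub>M\<^esub> = N"
    using M.a_coset_add_zero A.a_subset by simp
  have "abelian_group (quot_module M N)"
  proof (rule abelian_groupI)
    fix C assume "C \<in> carrier (quot_module M N)"
    then obtain v where v: "v \<in> carrier M" "C = N +>\<^bsub>M\<^esub> v" by (auto simp: quot_module_simps)
    then have "(N +>\<^bsub>M\<^esub> (\<ominus>\<^bsub>M\<^esub> v)) \<oplus>\<^bsub>quot_module M N\<^esub> C = \<zero>\<^bsub>quot_module M N\<^esub>"
      using zero by (simp add: quot_module_simps M.l_neg)
    then show "\<exists>D\<in>carrier (quot_module M N). D \<oplus>\<^bsub>quot_module M N\<^esub> C = \<zero>\<^bsub>quot_module M N\<^esub>"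
      using v by (auto simp: quot_module_simps)
    show "\<zero>\<^bsub>quot_module M N\<^esub> \<oplus>\<^bsub>quot_module M N\<^esub> C = C"
      using v zero quot_module_simps(3)[of "\<zero>\<^bsub>M\<^esub>" v] by (simp add: quot_module_simps)
  next
    show "\<zero>\<^bsub>quot_module M N\<^esub> \<in> carrier (quot_module M N)"
      using zero by (auto simp: quot_module_simps intro: rev_image_eqI)
  qed (auto simp: quot_module_simps M.a_ac)
  then show ?thesis
    by (intro left_module.intro left_module_axioms.intro M.ring_axioms)
      (auto simp: quot_module_simps quot_module_smult M.smult_closed M.smult_l_distr
        M.smult_r_distr M.smult_assoc M.smult_one)
qed

end

section \<open>The action on \<open>V(\<rho>)\<close>\<close>

text \<open>The vector \<open>v\<^sub>0\<close> is \<open>single 0 1\<close>. The simplifier must not turn it into the unit of the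
  convolution product on \<open>nat \<Rightarrow>\<^sub>0 'k\<close>, which has no meaning for a module.\<close>

declare single_one [simp del]

locale lowest_weight_rep =
  fixes \<chi> :: "'g::ab_group_add \<Rightarrow> 'k::field" and b c :: 'g and \<rho> :: "'g \<Rightarrow> 'k"
  assumes chi: "\<chi> \<in> carrier char_group" and rho: "\<rho> \<in> carrier char_group"
begin

abbreviation r :: "nat \<Rightarrow> 'k" where
  "r i \<equiv> char_ext \<rho> (sigma_sum \<chi> (e_elt b c) i)"

abbreviation gen_act :: "'g gen \<Rightarrow> (nat \<Rightarrow>\<^sub>0 'k) \<Rightarrow> (nat \<Rightarrow>\<^sub>0 'k)" where
  "gen_act a \<equiv> lin_ext (basis_act \<chi> b c \<rho> a)"

abbreviation act :: "('g, 'k) free_alg \<Rightarrow> (nat \<Rightarrow>\<^sub>0 'k) \<Rightarrow> (nat \<Rightarrow>\<^sub>0 'k)" where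
  "act \<equiv> free_act \<chi> b c \<rho>"

abbreviation HC :: "('g, 'k) free_alg \<Rightarrow> ('g, 'k) free_alg set" where
  "HC \<equiv> H_class \<chi> b c"

abbreviation H :: "('g, 'k) free_alg set ring" where "H \<equiv> H_alg \<chi> b c"

abbreviation V :: "(('g, 'k) free_alg set, nat \<Rightarrow>\<^sub>0 'k) module" where "V \<equiv> V_mod \<chi> b c \<rho>"

lemma char_ext_inv_sigma_single:
  "char_ext \<rho> ((inv_into UNIV (sigma \<chi>) ^^ i) (single g 1)) = \<rho> g / \<chi> g ^ i"
proof -
  have "(inv_into UNIV (sigma \<chi>) ^^ i) (single g 1) = single g (1 / \<chi> g ^ i)"
    using char_groupD(1)[OF chi]
    by (auto intro!: poly_mapping_eqI simp: inv_sigma_pow lookup_single when_def)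
  then show ?thesis by simp
qed

lemma r_0 [simp]: "r 0 = 0"
  by (simp add: sigma_sum_def)

text \<open>The recursion behind the relation \<open>yx = xy + e\<close>: the increment is the scalar by which \<open>e\<close> acts on
  \<open>v\<^sub>i\<close>.\<close>

lemma r_Suc: "r (Suc i) = r i + (\<rho> (- c) / \<chi> (- c) ^ i - \<rho> b / \<chi> b ^ i)"
proof -
  have "(inv_into UNIV (sigma \<chi>) ^^ i) (e_elt b c)
      = single (- c) (1 / \<chi> (- c) ^ i) + single b (- 1 / \<chi> b ^ i)"
    using char_groupD(1)[OF chi]
    by (auto intro!: poly_mapping_eqI
        simp: inv_sigma_pow lookup_single when_def e_elt_def lookup_minus lookup_add)
  then show ?thesis by (simp add: sigma_sum_def char_ext_add)
qed

lemma lookup_Grp_act: "lookup (gen_act (Grp g) v) i = \<rho> g / \<chi> g ^ i * lookup v i"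
  by (induction v rule: poly_mapping_additive_induct)
    (auto simp: lin_ext_add lookup_add char_ext_inv_sigma_single lookup_single when_def algebra_simps
      add_divide_distrib)

lemma lookup_X_act: "lookup (gen_act Xg v) i = (case i of 0 \<Rightarrow> 0 | Suc j \<Rightarrow> lookup v j)"
  by (induction v rule: poly_mapping_additive_induct)
    (auto simp: lin_ext_add lookup_add lookup_single when_def split: nat.split)

lemma lookup_Y_act: "lookup (gen_act Yg v) i = r (Suc i) * lookup v (Suc i)"
proof (induction v rule: poly_mapping_additive_induct)
  case (single j a)
  show ?case by (cases j) (auto simp: lookup_single when_def)
qed (simp add: lin_ext_add lookup_add algebra_simps)

lemmas lookup_act = lookup_Grp_act lookup_X_act lookup_Y_act

lemma word_act_add:
  "foldr gen_act w (v + v') = foldr gen_act w v + foldr gen_act w v'"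
  by (induction w) (simp_all add: lin_ext_add)

lemma word_act_vscale: "foldr gen_act w (vscale a v) = vscale a (foldr gen_act w v)"
  by (induction w) (simp_all add: lin_ext_vscale)

lemma act_add_left: "act (p + q) v = act p v + act q v"
  by (simp add: free_act_def lin_ext_add)

lemma act_add_right: "act p (v + w) = act p v + act p w"
  by (simp add: free_act_def word_act_add lin_ext_add_fun)

lemma act_vscale: "act p (vscale a v) = vscale a (act p v)"
  by (simp add: free_act_def word_act_vscale lin_ext_vscale_fun)

lemma act_single: "act (single w a) v = vscale a (foldr gen_act (letters w) v)"
  by (simp add: free_act_def)

lemma act_gen [simp]: "act (gen a) v = gen_act a v"
  by (simp add: gen_def act_single)

lemma act_scal [simp]: "act (scal a) v = vscale a v"
  by (simp add: scal_def act_single zero_free_monoid_def)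

lemma act_one [simp]: "act 1 v = v"
  using act_scal[of 1] by (simp add: scal_def single_one)

text \<open>The action is linear in both factors, and on words it is the composition of the actions of the
  letters; concatenation of words therefore becomes composition.\<close>

lemma act_mult: "act (p * q) v = act p (act q v)"
proof (induction p rule: poly_mapping_additive_induct)
  case (add p p')
  then show ?case by (simp add: distrib_right act_add_left)
next
  case (single u x)
  show ?case
  proof (induction q rule: poly_mapping_additive_induct)
    case (add q q')
    then show ?case by (simp add: distrib_left act_add_left act_add_right)
  next
    case (single w y)
    show ?case by (simp add: mult_single act_single plus_free_monoid_def word_act_vscale)
  qed
qed

lemma act_zero [simp]: "act p 0 = 0" "act 0 v = 0"
  using act_vscale[of p 0 0] by (simp_all add: free_act_def)

lemma act_uminus [simp]: "act (- p) v = - act p v"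
  using act_add_left[of "- p" p v] by (simp add: eq_neg_iff_add_eq_0)

lemma act_diff: "act (p - q) v = act p v - act q v"
  using act_add_left[of p "- q" v] by simp

lemma act_closed:
  assumes "v \<in> S" "0 \<in> S"
    and "\<And>v w. v \<in> S \<Longrightarrow> w \<in> S \<Longrightarrow> v + w \<in> S" "\<And>a v. v \<in> S \<Longrightarrow> vscale a v \<in> S"
    and gen: "\<And>a v. v \<in> S \<Longrightarrow> gen_act a v \<in> S"
  shows "act p v \<in> S"
proof (induction p rule: poly_mapping_additive_induct)
  case (single w a)
  have "foldr gen_act xs v \<in> S" for xs
    by (induction xs) (simp_all add: assms(1) gen)
  then show ?case by (simp add: act_single assms)
qed (simp add: act_add_left assms)

text \<open>Compared at \<open>v\<^sub>i\<close>: moving \<open>g\<close> past \<open>x\<close> or \<open>y\<close> shifts the exponent of \<open>\<chi>(g)\<close> in the weight of \<open>g\<close> by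
  one, which the factors \<open>\<chi>(g)\<close> and \<open>1/\<chi>(g)\<close> make up for, and the last relation is the recursion
  for \<open>r\<close>.\<close>

lemma act_rels:
  assumes "p \<in> H_rels \<chi> b c"
  shows "act p v = 0"
proof (rule poly_mapping_eqI)
  note ch = char_groupD[OF chi] char_groupD[OF rho]
  fix i
  from assms consider "p = gen (Grp 0) - 1"
    | g h where "p = gen (Grp g) * gen (Grp h) - gen (Grp (g + h))"
    | g where "p = gen Xg * gen (Grp g) - scal (\<chi> g) * gen (Grp g) * gen Xg"
    | g where "p = gen Yg * gen (Grp g) - scal (inverse (\<chi> g)) * gen (Grp g) * gen Yg"
    | "p = gen Yg * gen Xg - (gen Xg * gen Yg + (gen (Grp (- c)) - gen (Grp b)))"
    unfolding H_rels_def by blast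
  then show "lookup (act p v) i = lookup 0 i"
  proof cases
    case 1
    show ?thesis unfolding 1 by (simp add: act_diff lookup_minus lookup_act ch)
  next
    case 2
    show ?thesis unfolding 2
      by (simp add: act_diff act_mult lookup_minus lookup_act ch power_mult_distrib)
  next
    case 3
    show ?thesis unfolding 3
      by (simp add: act_diff act_mult lookup_minus lookup_act ch split: nat.split)
  next
    case 4
    show ?thesis unfolding 4
      by (simp add: act_diff act_mult lookup_minus lookup_act ch field_simps)
  next
    case 5
    show ?thesis
      unfolding 5
      by (cases i) (simp_all add: act_diff act_add_left act_mult lookup_minus lookup_add lookup_act
          r_Suc algebra_simps)
  qed
qed

text \<open>The elements of the free algebra that act as \<open>0\<close> form an ideal that contains the relations.\<close>

lemma act_H_ideal:
  assumes "p \<in> H_ideal \<chi> b c"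
  shows "act p v = 0"
proof -
  let ?A = "{p. \<forall>v. act p v = 0}"
  have "ideal ?A free_alg_ring"
  proof (rule idealI[OF ring_free_alg])
    interpret F: ring "free_alg_ring :: ('g, 'k) free_alg ring" by (rule ring_free_alg)
    show "subgroup ?A (add_monoid free_alg_ring)"
    proof (rule F.add.subgroupI)
      fix p assume "p \<in> ?A"
      moreover have "\<ominus>\<^bsub>free_alg_ring\<^esub> p = - p"
        using F.minus_equality[of "- p" p] by simp
      ultimately show "\<ominus>\<^bsub>free_alg_ring\<^esub> p \<in> ?A" by simp
    qed (auto simp: act_add_left intro: exI[of _ 0])
  qed (auto simp: act_mult)
  then have "H_ideal \<chi> b c \<subseteq> ?A"
    unfolding H_ideal_def by (intro ring.genideal_minimal[OF ring_free_alg]) (auto simp: act_rels)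
  with assms show ?thesis by blast
qed

text \<open>By the vanishing of the ideal, all representatives of an element of \<open>H\<close> act alike, and
  \<open>the_elem\<close> in the definition of \<open>V(\<rho>)\<close> is applied to a singleton.\<close>

lemma V_simps [simp]:
  "carrier V = UNIV" "v \<oplus>\<^bsub>V\<^esub> w = v + w" "\<zero>\<^bsub>V\<^esub> = 0" "HC p \<odot>\<^bsub>V\<^esub> v = act p v"
proof -
  have "(\<lambda>p. act p v) ` HC p = {act p v}"
    using additive_subgroup.zero_closed[OF ideal.axioms(1)[OF ideal_H_ideal], of \<chi> b c]
    by (auto simp: H_class_eq act_add_left act_H_ideal image_image)
  then show "HC p \<odot>\<^bsub>V\<^esub> v = act p v" by (simp add: V_mod_def)
qed (simp_all add: V_mod_def)

lemma left_module_V: "left_module H V"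
proof -
  have "abelian_group V"
  proof (rule abelian_groupI)
    fix v :: "nat \<Rightarrow>\<^sub>0 'k"
    have "- v + v = 0" by simp
    then show "\<exists>w\<in>carrier V. w \<oplus>\<^bsub>V\<^esub> v = \<zero>\<^bsub>V\<^esub>"
      by (metis V_simps(1-3) UNIV_I)
  qed (simp_all add: add_ac)
  then show ?thesis
    by (intro left_module.intro left_module_axioms.intro ring_H_alg)
      (auto simp: H_alg_simps act_add_left act_add_right act_mult)
qed

section \<open>The submodule \<open>Hv\<^sub>d\<close> and the quotient by it\<close>

text \<open>The indices \<open>i\<close> from which \<open>y\<close> leads down to \<open>v\<^sub>0\<close> without meeting a zero coefficient. This is
  \<open>{0, \<dots>, d-1}\<close> if \<open>d\<close> exists and all of \<open>\<nat>\<close> otherwise, which makes it possible to treat both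
  cases at once.\<close>

definition low :: "nat set" where
  "low = {i. \<forall>j. 0 < j \<and> j \<le> i \<longrightarrow> r j \<noteq> 0}"

definition W :: "(nat \<Rightarrow>\<^sub>0 'k) set" where
  "W = {v. \<forall>i\<in>low. lookup v i = 0}"

lemma low_0 [simp]: "0 \<in> low"
  unfolding low_def by blast

lemma low_Suc: "Suc i \<in> low \<longleftrightarrow> i \<in> low \<and> r (Suc i) \<noteq> 0"
  by (auto simp: low_def le_Suc_eq)

lemma low_has_d:
  assumes "has_d \<chi> b c \<rho>"
  shows "low = {..<the_d \<chi> b c \<rho>}" "r (the_d \<chi> b c \<rho>) = 0"
proof -
  have d: "0 < the_d \<chi> b c \<rho> \<and> r (the_d \<chi> b c \<rho>) = 0"
    unfolding the_d_def using assms unfolding has_d_def by (rule LeastI_ex)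
  then show "r (the_d \<chi> b c \<rho>) = 0" by simp
  have "r j \<noteq> 0" if "0 < j" "j < the_d \<chi> b c \<rho>" for j
    using not_less_Least[OF that(2)[unfolded the_d_def]] that(1) by simp
  then have "i \<in> low" if "i < the_d \<chi> b c \<rho>" for i
    using that unfolding low_def by (blast intro: le_less_trans)
  moreover have "i < the_d \<chi> b c \<rho>" if "i \<in> low" for i
    using that d unfolding low_def by (blast intro: leI)
  ultimately show "low = {..<the_d \<chi> b c \<rho>}" by blast
qed

lemma low_no_d: "\<not> has_d \<chi> b c \<rho> \<Longrightarrow> low = UNIV"
  unfolding low_def has_d_def by blast

text \<open>The only generator that lowers degrees is \<open>y\<close>, and it cannot move a vector from outside into the
  low degrees: the coefficient \<open>r\<close> at the first index that is not low is \<open>0\<close>.\<close>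

lemma act_W:
  assumes "v \<in> W"
  shows "act p v \<in> W"
proof (rule act_closed[OF assms])
  fix a v assume v: "v \<in> W"
  show "gen_act a v \<in> W"
  proof (cases a)
    case Yg
    have "r (Suc i) * lookup v (Suc i) = 0" if "i \<in> low" for i
      using v that by (auto simp: W_def low_Suc)
    then show ?thesis by (simp add: Yg W_def lookup_act)
  qed (use v in \<open>auto simp: W_def lookup_act low_Suc split: nat.split\<close>)
qed (auto simp: W_def lookup_add)

lemma act_X_power: "act (single (Word (replicate k Xg)) a) (single i x) = single (k + i) (a * x)"
proof -
  have "foldr gen_act (replicate k Xg) (single i x) = single (k + i) x" by (induction k) simp_all
  then show ?thesis by (simp add: act_single)
qed

text \<open>The submodule generated by \<open>v\<^sub>d\<close> stays in degrees \<open>\<ge> d\<close>, and it contains every \<open>v\<^sub>i\<close> with \<open>i \<ge> d\<close>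
  because \<open>x\<close> shifts the basis by one.\<close>

lemma Hv_d_eq: "Hv_d \<chi> b c \<rho> = W"
proof (cases "has_d \<chi> b c \<rho>")
  case False
  then show ?thesis
    by (auto simp: Hv_d_def W_def low_no_d intro: poly_mapping_eqI)
next
  case True
  let ?d = "the_d \<chi> b c \<rho>"
  note low = low_has_d[OF True]
  have eq: "Hv_d \<chi> b c \<rho> = range (\<lambda>p. act p (single ?d 1))"
    using True by (simp add: Hv_d_def H_alg_simps image_image)
  have "v \<in> range (\<lambda>p. act p (single ?d 1))" if v: "v \<in> W" for v
  proof -
    have "sum (\<lambda>i. single i (lookup v i)) S \<in> range (\<lambda>p. act p (single ?d 1))"
      if "finite S" "S \<subseteq> Poly_Mapping.keys v" for S
      using that
    proof (induction S)
      case empty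
      show ?case by (rule image_eqI[of _ _ 0]) simp_all
    next
      case (insert i S)
      then obtain p where p: "(\<Sum>i\<in>S. single i (lookup v i)) = act p (single ?d 1)" by auto
      have "\<not> i < ?d" using insert v low by (auto simp: W_def in_keys_iff)
      then have "single i (lookup v i) =
          act (single (Word (replicate (i - ?d) Xg)) (lookup v i)) (single ?d 1)"
        by (simp add: act_X_power)
      then have "(\<Sum>i\<in>insert i S. single i (lookup v i)) =
          act (single (Word (replicate (i - ?d) Xg)) (lookup v i) + p) (single ?d 1)"
        unfolding sum.insert[OF insert.hyps] p act_add_left by (rule arg_cong2[OF _ refl])
      then show ?case by blast
    qed
    from this[of "Poly_Mapping.keys v"] show ?thesis
      by (simp add: poly_mapping_eq_sum_single[symmetric])
  qed
  moreover have "act p (single ?d 1) \<in> W" for p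
    by (rule act_W) (auto simp: W_def low lookup_single when_def)
  ultimately show ?thesis unfolding eq by blast
qed

lemma submodule_W: "submodule W H V"
proof (intro submodule.intro submodule_axioms.intro)
  interpret V: left_module H V by (rule left_module_V)
  show "subgroup W (add_monoid V)"
  proof (rule V.add.subgroupI)
    fix v assume "v \<in> W"
    moreover have "\<ominus>\<^bsub>V\<^esub> v = - v" using V.minus_equality[of "- v" v] by simp
    ultimately show "\<ominus>\<^bsub>V\<^esub> v \<in> W" by (simp add: W_def)
  qed (auto simp: W_def lookup_add intro: exI[of _ 0])
qed (auto simp: H_alg_simps act_W)

abbreviation Vbar :: "(('g, 'k) free_alg set, (nat \<Rightarrow>\<^sub>0 'k) set) module" where
  "Vbar \<equiv> Vbar_mod \<chi> b c \<rho>"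

text \<open>The coset of \<open>v\<close>, given by the coefficients that determine it; \<open>coset_eq_cls\<close> identifies it.\<close>

definition cls :: "(nat \<Rightarrow>\<^sub>0 'k) \<Rightarrow> (nat \<Rightarrow>\<^sub>0 'k) set" where
  "cls v = {w. \<forall>i\<in>low. lookup w i = lookup v i}"

lemma cls_eq_iff: "cls v = cls w \<longleftrightarrow> (\<forall>i\<in>low. lookup v i = lookup w i)"
  by (auto simp: cls_def)

lemma coset_eq_cls: "W +>\<^bsub>V\<^esub> v = cls v"
proof -
  have "cls v = (\<lambda>h. h + v) ` W"
  proof (intro equalityI subsetI)
    fix w assume "w \<in> cls v"
    then show "w \<in> (\<lambda>h. h + v) ` W"
      by (intro image_eqI[of _ _ "w - v"]) (auto simp: cls_def W_def lookup_minus)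
  qed (auto simp: cls_def W_def lookup_add)
  then show ?thesis by (auto simp: a_r_coset_def')
qed

lemma Vbar_simps:
  "carrier Vbar = range cls" "\<zero>\<^bsub>Vbar\<^esub> = cls 0"
  "cls v \<oplus>\<^bsub>Vbar\<^esub> cls w = cls (v + w)" "HC p \<odot>\<^bsub>Vbar\<^esub> cls v = cls (act p v)"
proof -
  have eq: "Vbar = quot_module V W" by (simp add: Vbar_mod_def Hv_d_eq)
  note Q = quot_module_simps[OF left_module_V submodule_W, folded eq, unfolded coset_eq_cls V_simps]
  show "carrier Vbar = range cls" by (rule Q(1))
  show "\<zero>\<^bsub>Vbar\<^esub> = cls 0" unfolding Q(2) by (simp add: cls_def W_def)
  show "cls v \<oplus>\<^bsub>Vbar\<^esub> cls w = cls (v + w)" by (rule Q(3)) simp_all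
  show "HC p \<odot>\<^bsub>Vbar\<^esub> cls v = cls (act p v)"
    using quot_module_smult[OF left_module_V submodule_W, of "HC p" v, folded eq]
    by (simp add: coset_eq_cls H_alg_simps)
qed

lemma left_module_Vbar: "left_module H Vbar"
  unfolding Vbar_mod_def Hv_d_eq by (rule left_module_quot[OF left_module_V submodule_W])

text \<open>The kernel of \<open>y\<close> on the quotient is the line through \<open>v\<^sub>0\<close>: if \<open>i + 1\<close> is low, the \<open>i\<close>-th
  coefficient of \<open>y w\<close> is a nonzero multiple of the \<open>(i+1)\<close>-st coefficient of \<open>w\<close>.\<close>

lemma cls_killed_by_Y:
  assumes "cls (act (gen Yg) w) = cls 0"
  shows "cls w = cls (single 0 (lookup w 0))"
  unfolding cls_eq_iff
proof
  fix i assume "i \<in> low"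
  then show "lookup w i = lookup (single 0 (lookup w 0)) i"
    using assms by (cases i) (auto simp: cls_eq_iff lookup_act low_Suc lookup_single)
qed

text \<open>The only eigenvalue of \<open>g\<close> on the kernel of \<open>y\<close> is \<open>\<rho>(g)\<close>. The condition on \<open>w\<close> is phrased through
  the action of elements of \<open>H\<close> alone, so that it can be transported along isomorphisms.\<close>

lemma lowest_weight_unique:
  assumes "cls (act (gen Yg) w) = cls 0" "cls w \<noteq> cls 0"
    and "cls (act (gen (Grp g) - scal a) w) = cls 0"
  shows "\<rho> g = a"
proof -
  have "lookup w 0 \<noteq> 0"
    using cls_killed_by_Y[OF assms(1)] assms(2) by (metis single_zero)
  moreover have "lookup (act (gen (Grp g) - scal a) w) 0 = lookup 0 (0::nat)"
    using assms(3) low_0 unfolding cls_eq_iff by blast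
  then have "(\<rho> g - a) * lookup w 0 = 0"
    by (simp add: act_diff lookup_minus lookup_act left_diff_distrib)
  ultimately show ?thesis by simp
qed

lemma act_mem_submodule:
  assumes "submodule N H Vbar" "cls w \<in> N"
  shows "cls (act p w) \<in> N"
  using submodule.smult_closed[OF assms(1) _ assms(2), of "HC p"]
  by (simp add: H_alg_simps Vbar_simps)

text \<open>Each application of \<open>y\<close> lowers the top low degree \<open>m\<close> of \<open>w\<close> by exactly one, because the
  coefficient \<open>r\<^sub>m\<close> is not zero; after \<open>m\<close> steps a nonzero multiple of \<open>v\<^sub>0\<close> remains.\<close>

lemma lowest_vector_mem_submodule:
  assumes N: "submodule N H Vbar"
    and "m \<in> low" "cls w \<in> N" "lookup w m \<noteq> 0" "\<And>i. i \<in> low \<Longrightarrow> m < i \<Longrightarrow> lookup w i = 0"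
  shows "cls (single 0 1) \<in> N"
  using assms(2-)
proof (induction m arbitrary: w)
  case 0
  have "cls (act (scal (1 / lookup w 0)) w) \<in> N"
    by (rule act_mem_submodule[OF N "0.prems"(2)])
  moreover have "cls (act (scal (1 / lookup w 0)) w) = cls (single 0 1)"
    using 0 by (auto simp: cls_eq_iff lookup_single when_def)
  ultimately show ?case by simp
next
  case (Suc m)
  show ?case
  proof (rule Suc.IH)
    show "m \<in> low" using Suc.prems(1) by (simp add: low_Suc)
    show "cls (act (gen Yg) w) \<in> N"
      by (rule act_mem_submodule[OF N Suc.prems(2)])
    show "lookup (act (gen Yg) w) m \<noteq> 0"
      using Suc.prems by (simp add: lookup_act low_Suc)
    fix i assume "i \<in> low" "m < i"
    then show "lookup (act (gen Yg) w) i = 0"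
      using Suc.prems(4)[of "Suc i"] by (auto simp: lookup_act low_Suc)
  qed
qed

lemma submodule_eq_carrier:
  assumes N: "submodule N H Vbar" and "cls (single 0 1) \<in> N"
  shows "N = carrier Vbar"
proof -
  interpret N: submodule N H Vbar by (rule N)
  have "cls v \<in> N" for v
  proof (induction v rule: poly_mapping_additive_induct)
    case (add u v)
    then show ?case using N.m_closed[of "cls u" "cls v"] by (simp add: Vbar_simps)
  next
    case (single i a)
    show ?case
      using act_mem_submodule[OF assms, of "single (Word (replicate i Xg)) a"]
      by (simp add: act_X_power)
  qed
  moreover have "N \<subseteq> range cls" using N.subset by (simp add: Vbar_simps)
  ultimately show ?thesis by (auto simp: Vbar_simps)
qed

text \<open>There are finitely many low degrees, so a vector that is not \<open>0\<close> in the quotient has a top low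
  degree, and \<open>lowest_vector_mem_submodule\<close> applies.\<close>

lemma simple_Vbar:
  assumes "has_d \<chi> b c \<rho>"
  shows "simple_module H Vbar"
  unfolding simple_module_def
proof (intro conjI allI impI left_module_Vbar)
  have "cls (single 0 1) \<noteq> cls 0" by (auto simp: cls_eq_iff lookup_single intro!: bexI[of _ 0])
  then show "carrier Vbar \<noteq> {\<zero>\<^bsub>Vbar\<^esub>}" by (auto simp: Vbar_simps)
  fix N assume N: "submodule N H Vbar"
  interpret N: submodule N H Vbar by (rule N)
  show "N = {\<zero>\<^bsub>Vbar\<^esub>} \<or> N = carrier Vbar"
  proof (cases "N \<subseteq> {cls 0}")
    case True
    then show ?thesis using N.one_closed by (auto simp: Vbar_simps)
  next
    case False
    then obtain w where w: "cls w \<in> N" "cls w \<noteq> cls 0"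
      using N.subset by (force simp: Vbar_simps)
    let ?M = "{i \<in> low. lookup w i \<noteq> 0}"
    have fin: "finite ?M" using low_has_d(1)[OF assms] by simp
    have "?M \<noteq> {}" using w(2) by (auto simp: cls_eq_iff)
    then have "Max ?M \<in> ?M" using Max_in[OF fin] by blast
    moreover have "lookup w i = 0" if "i \<in> low" "Max ?M < i" for i
    proof (rule ccontr)
      assume "lookup w i \<noteq> 0"
      then have "i \<le> Max ?M" using that(1) by (intro Max_ge[OF fin]) simp
      with that(2) show False by simp
    qed
    ultimately have "cls (single 0 1) \<in> N"
      using lowest_vector_mem_submodule[OF N, of "Max ?M" w] w(1) by blast
    then show ?thesis using submodule_eq_carrier[OF N] by blast
  qed
qed

lemma fin_dim_Vbar:
  assumes "has_d \<chi> b c \<rho>"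
  shows "H_fin_dim \<chi> b c Vbar"
proof -
  interpret Vb: left_module H Vbar by (rule left_module_Vbar)
  let ?v = "\<lambda>i. cls (single i 1)"
  have fin: "finite low" using low_has_d(1)[OF assms] by simp
  have inj: "inj_on ?v low"
    by (rule inj_onI) (force simp: cls_eq_iff lookup_single when_def split: if_splits)
  have sum: "(\<Oplus>\<^bsub>Vbar\<^esub>i\<in>S. cls (f i)) = cls (\<Sum>i\<in>S. f i)" if "finite S" for S :: "nat set" and f
    using that
  proof (induction S)
    case (insert i S)
    then show ?case
      by (subst Vb.finsum_insert) (auto simp: Vbar_simps)
  qed (simp add: Vbar_simps)
  have "\<exists>a. cls v = (\<Oplus>\<^bsub>Vbar\<^esub>w\<in>?v ` low. H_scal \<chi> b c (a w) \<odot>\<^bsub>Vbar\<^esub> w)" for v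
  proof
    let ?a = "\<lambda>C. lookup v (the_inv_into low ?v C)"
    have H: "H_scal \<chi> b c k \<odot>\<^bsub>Vbar\<^esub> cls u = cls (vscale k u)" for k u
      using Vbar_simps(4)[of "scal k" u] by (simp add: H_scal_def H_class_def)
    have "(\<Oplus>\<^bsub>Vbar\<^esub>w\<in>?v ` low. H_scal \<chi> b c (?a w) \<odot>\<^bsub>Vbar\<^esub> w)
        = (\<Oplus>\<^bsub>Vbar\<^esub>i\<in>low. H_scal \<chi> b c (?a (?v i)) \<odot>\<^bsub>Vbar\<^esub> ?v i)"
      by (rule Vb.finsum_reindex[OF _ inj]) (auto simp: H Vbar_simps)
    also have "\<dots> = (\<Oplus>\<^bsub>Vbar\<^esub>i\<in>low. cls (single i (lookup v i)))"
      by (rule Vb.finsum_cong') (auto simp: H the_inv_into_f_f[OF inj] Vbar_simps)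
    also have "\<dots> = cls (\<Sum>i\<in>low. single i (lookup v i))"
      by (rule sum[OF fin])
    also have "\<dots> = cls v"
      using fin by (simp add: cls_eq_iff lookup_sum lookup_single when_def sum.delta)
    finally show "cls v = (\<Oplus>\<^bsub>Vbar\<^esub>w\<in>?v ` low. H_scal \<chi> b c (?a w) \<odot>\<^bsub>Vbar\<^esub> w)" ..
  qed
  then show ?thesis
    unfolding H_fin_dim_def using fin by (intro exI[of _ "?v ` low"]) (auto simp: Vbar_simps)
qed

text \<open>With \<open>q = \<chi>(b) = \<chi>(c)\<close>, the recursion gives
  \<open>r\<^sub>i = (1 + q + \<dots> + q ^ (i-1)) / \<rho>(c) - \<rho>(b) (1 + 1/q + \<dots> + 1/q ^ (i-1))\<close>, and both sums vanish for
  \<open>i = n\<close>. For \<open>q = 1\<close> they are equal to \<open>i\<close> instead.\<close>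

lemma has_d_root_of_unity:
  assumes "\<chi> b = \<chi> c" "\<chi> b \<noteq> 1" "\<chi> b ^ n = 1" "n > 0"
  shows "has_d \<chi> b c \<rho>"
proof -
  note ch = char_groupD[OF chi]
  have "r i = \<rho> (- c) * (\<Sum>k<i. \<chi> b ^ k) - \<rho> b * (\<Sum>k<i. inverse (\<chi> b) ^ k)" for i
    by (induction i) (simp_all add: r_Suc ch assms(1) power_inverse divide_inverse algebra_simps)
  moreover have "(\<Sum>k<n. \<chi> b ^ k) = 0" "(\<Sum>k<n. inverse (\<chi> b) ^ k) = 0"
    using assms geometric_sum[of "\<chi> b" n] geometric_sum[of "inverse (\<chi> b)" n]
    by (simp_all add: power_inverse)
  ultimately have "r n = 0" by simp
  with \<open>n > 0\<close> show ?thesis unfolding has_d_def by blast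
qed

end

text \<open>The image of \<open>v\<^sub>0\<close> under an isomorphism is killed by \<open>y\<close> and by \<open>g - \<rho>(g)\<close>, so \<open>\<rho>(g)\<close> is the
  eigenvalue of \<open>g\<close> on the kernel of \<open>y\<close> in the target as well.\<close>

lemma Vbar_iso_imp_eq:
  fixes \<chi> \<rho> \<rho>' :: "'g::ab_group_add \<Rightarrow> 'k::field"
  assumes "lowest_weight_rep \<chi> \<rho>" "lowest_weight_rep \<chi> \<rho>'"
    and f: "f \<in> module_isos (H_alg \<chi> b c) (Vbar_mod \<chi> b c \<rho>) (Vbar_mod \<chi> b c \<rho>')"
  shows "\<rho>' = \<rho>"
proof
  fix g
  interpret A: lowest_weight_rep \<chi> b c \<rho> by fact
  interpret B: lowest_weight_rep \<chi> b c \<rho>' by fact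
  let ?v = "single 0 1 :: nat \<Rightarrow>\<^sub>0 'k"
  have bij: "bij_betw f (range A.cls) (range B.cls)"
    using f by (simp add: module_isos_def A.Vbar_simps B.Vbar_simps)
  have lin: "f (A.cls (A.act p v)) = B.cls (B.act p w)" if "f (A.cls v) = B.cls w" for p v w
  proof -
    have "f (A.HC p \<odot>\<^bsub>A.Vbar\<^esub> A.cls v) = A.HC p \<odot>\<^bsub>B.Vbar\<^esub> f (A.cls v)"
      using f by (simp add: module_isos_def A.Vbar_simps(1) H_alg_simps)
    then show ?thesis by (simp add: that A.Vbar_simps(4) B.Vbar_simps(4))
  qed
  have "f (A.cls ?v) \<in> range B.cls"
    using bij by (rule bij_betw_apply) simp
  then obtain w where w: "f (A.cls ?v) = B.cls w" by blast
  have zero: "f (A.cls 0) = B.cls 0"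
    using lin[OF w, of 0] by simp
  have "B.cls (B.act p w) = B.cls 0" if "A.act p ?v = 0" for p
    using lin[OF w, of p] zero that by simp
  note kill = this
  have "A.act (gen Yg) ?v = 0" by simp
  moreover have "A.act (gen (Grp g) - scal (\<rho> g)) ?v = 0"
    by (auto intro!: poly_mapping_eqI
        simp: A.act_diff lookup_minus A.lookup_act lookup_single when_def simp del: lin_ext_single)
  moreover have "B.cls w \<noteq> B.cls 0"
  proof
    assume "B.cls w = B.cls 0"
    then have "A.cls ?v = A.cls 0"
      using inj_onD[OF bij_betw_imp_inj_on[OF bij], of "A.cls ?v" "A.cls 0"] w zero by simp
    then have "lookup ?v 0 = lookup (0 :: nat \<Rightarrow>\<^sub>0 'k) 0"
      using A.low_0 unfolding A.cls_eq_iff by blast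
    then show False by simp
  qed
  ultimately show "\<rho>' g = \<rho> g"
    using B.lowest_weight_unique kill by blast
qed

theorem proposition5p9:
  fixes \<chi> :: "'g::ab_group_add \<Rightarrow> 'k::{alg_closed_field, field_char_0}"
    and b c :: 'g and n :: nat
  assumes "fin_gen_group TYPE('g)"
    and "\<chi> \<in> carrier char_group"
    and "group.ord char_group \<chi> = n" and "n > 0"
    and "\<chi> b = \<chi> c"
    and "b + c \<noteq> 0"
  shows "inj_on (Vbar_class \<chi> b c) (carrier char_group)
    \<and> Vbar_class \<chi> b c \<in> {\<rho> \<in> carrier char_group. has_d \<chi> b c \<rho>} \<rightarrow> Irr \<chi> b c
    \<and> (\<chi> b \<noteq> 1 \<longrightarrow> Vbar_class \<chi> b c \<in> carrier char_group \<rightarrow> Irr \<chi> b c)"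
proof -
  have rep: "lowest_weight_rep \<chi> \<rho>" if "\<rho> \<in> carrier char_group" for \<rho>
    using that assms(2) by (rule lowest_weight_rep.intro[rotated])
  have "inj_on (Vbar_class \<chi> b c) (carrier char_group)"
  proof (rule inj_onI)
    fix \<rho> \<rho>' assume in_G: "\<rho> \<in> carrier char_group" "\<rho>' \<in> carrier char_group"
      and eq: "Vbar_class \<chi> b c \<rho> = Vbar_class \<chi> b c \<rho>'"
    have "Vbar_mod \<chi> b c \<rho> \<in> Vbar_class \<chi> b c \<rho>"
      using lowest_weight_rep.left_module_Vbar[OF rep[OF in_G(1)]]
        module_isos_id[of "H_alg \<chi> b c" "Vbar_mod \<chi> b c \<rho>"]
      by (auto simp: Vbar_class_def iso_class_def)
    then obtain f where
      "f \<in> module_isos (H_alg \<chi> b c) (Vbar_mod \<chi> b c \<rho>') (Vbar_mod \<chi> b c \<rho>)"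
      unfolding eq by (auto simp: Vbar_class_def iso_class_def)
    then show "\<rho> = \<rho>'" by (rule Vbar_iso_imp_eq[OF rep[OF in_G(2)] rep[OF in_G(1)]])
  qed
  moreover have "Vbar_class \<chi> b c \<rho> \<in> Irr \<chi> b c"
    if "\<rho> \<in> carrier char_group" "has_d \<chi> b c \<rho>" for \<rho>
    unfolding Vbar_class_def Irr_def
    using lowest_weight_rep.simple_Vbar[OF rep[OF that(1)] that(2)]
      lowest_weight_rep.fin_dim_Vbar[OF rep[OF that(1)] that(2)] by blast
  moreover have "has_d \<chi> b c \<rho>" if "\<rho> \<in> carrier char_group" "\<chi> b \<noteq> 1" for \<rho>
    using lowest_weight_rep.has_d_root_of_unity[OF rep[OF that(1)] assms(5) that(2) _ assms(4)]
      char_pow_ord[OF assms(2)] assms(3) by blast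
  ultimately show ?thesis by blast
qed

end
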